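(* Let the environment, observation model, costs and belief satisfy the four assumptions (static environment, piecewise observation model, convex quadratic cost, strict positivity) listed in the context, and let $V(x(t),z(t))$ be the value function of the mixed-integer problem defined in the context. If the observation model is not a function of the system's state, i.e. for some $G:\mathcal{E}\times\mathcal{O}\to[0,1]$ $$Z(e,o,x)=G(e,o)\qquad\forall x\in\mathcal{X},$$ then the value function $V(x(t),z(t))$ is convex in its arguments $(x(t),z(t))\in\mathbb{R}^n\times\mathbb{R}_+^{|\mathcal{E}|}$.
   Context: System: $x_{k+1}=Ax_k+Bu_k$, $x_k\in\mathbb{R}^n$, $u_k\in\mathbb{R}^d$, with constraints $u_k\in\mathcal{U}\subseteq\mathbb{R}^d$ and $x_k\in\mathcal{X}\subseteq\mathbb{R}^n$. Horizon $N\ge1$. $\mathbb{R}_+=(0,\infty)$. Environment: hidden Markov model $(\mathcal{E},\mathcal{O},T,Z)$ with finite sets $\mathcal{E}=\{1,\dots,|\mathcal{E}|\}$ and $\mathcal{O}=\{1,\dots,|\mathcal{O}|\}$, $T(e',e,x)=\mathbb{P}(e'|e,x)$ and $Z(e,o,x)=\mathbb{P}(o|e,x)$ (so $\sum_{e'}T(e',e,x)=1$, $\sum_oZ(e,o,x)=1$). Assumptions: 1. (Static environment) $T(e,e,x)=1$ and $T(e',e,x)=0$ for all $e'\ne e$ and all $x$. 2. (Piecewise observation model) There are $R$ pairwise disjoint polytopic regions $\mathcal{X}_1,\dots,\mathcal{X}_R$ (each described by finitely many affine inequalities, strict or non-strict) with $\bigcup_{i=1}^R\mathcal{X}_i=\mathcal{X}$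 and functions $M_i:\mathcal{E}\times\mathcal{O}\to[0,1]$ such that $Z(e,o,x)=M_i(e,o)$ if $x\in\mathcal{X}_i$. 3. (Convex quadratic cost) $h:\mathbb{R}^n\times\mathbb{R}^d\times\mathcal{E}\to\mathbb{R}$ and $h_N:\mathbb{R}^n\times\mathcal{E}\to\mathbb{R}$ are $h(x,u,e)=\|x-x_g^{(e)}\|_{Q}+\|u-u_g^{(e)}\|_{Q_u}$ and $h_N(x,e)=\|x-x_g^{(e)}\|_{Q_N}$, where $\|y\|_{S}:=y^\top Sy$, the matrices $Q,Q_u,Q_N$ are positive semi-definite, and $x_g^{(e)}\in\mathbb{R}^n$, $u_g^{(e)}\in\mathbb{R}^d$ are given. 4. (Strict positivity) The belief vector $b$ (a probability vector on $\mathcal{E}$, with inverse belief $z=1/b$ entrywise) has strictly positive entries, and $Z$ takes values in the open interval $(0,1)$. Notation: $\mathbf{o}_k=[o_1,\dots,o_k]\in\mathcal{O}^k$. $\mathcal{O}^0$ is a singleton with element $\mathbf{o}_0$, and $\mathbf{o}_{-1}=\mathbf{o}_0$. When $\mathbf{o}_k$ and $\mathbf{o}_{k-1}$ (or $\mathbf{o}_{k+1}$ and $\mathbf{o}_k$) appear together, the shorter one is the prefix of the longer one. $\mathds{1}_{S}$ is the indicator function of $S$. "$\min$" denotes the optimal value (infimum; $+\infty$ if infeasible), so $V$ is extended-real-valued. Mixed-integer problem: with $D_i(o)\in\mathbb{R}^{|\mathcal{E}|\times|\mathcal{E}|}$ diagonal, $D_i(o)[e,e]=1/M_i(e,o)$,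 $$V(x(t),z(t))=\min_{\mathbf{u},\boldsymbol\delta}\ \sum_{k=0}^{N-1}\sum_{\mathbf{o}_k\in\mathcal{O}^k}\sum_{e\in\mathcal{E}}\frac{h(x_k^{\mathbf{o}_{k-1}},u_k^{\mathbf{o}_k},e)}{z_k^{\mathbf{o}_k}[e]}+\sum_{\mathbf{o}_N\in\mathcal{O}^N}\sum_{e\in\mathcal{E}}\frac{h_N(x_N^{\mathbf{o}_{N-1}},e)}{z_N^{\mathbf{o}_N}[e]}$$ over inputs $u_k^{\mathbf{o}_k}\in\mathbb{R}^d$ ($0\le k\le N-1$, $\mathbf{o}_k\in\mathcal{O}^k$) and binary variables $\delta_{k+1,i}^{\mathbf{o}_k}\in\{0,1\}$ ($0\le k\le N-1$, $1\le i\le R$, $\mathbf{o}_k\in\mathcal{O}^k$), subject to $x_0^{\mathbf{o}_{-1}}=x(t)$, $z_0^{\mathbf{o}_0}=z(t)$, and for all $k\in\{0,\dots,N-1\}$ and all observation sequences: $x_{k+1}^{\mathbf{o}_k}=Ax_k^{\mathbf{o}_{k-1}}+Bu_k^{\mathbf{o}_k}$; $\ u_k^{\mathbf{o}_k}\in\mathcal{U}$; $\ x_k^{\mathbf{o}_{k-1}}\in\mathcal{X}$ and $x_{k+1}^{\mathbf{o}_k}\in\mathcal{X}$; $\ z_{k+1}^{\mathbf{o}_{k+1}}=\sum_{i=1}^RD_i(o_{k+1})\,z_k^{\mathbf{o}_k}\,\delta_{k+1,i}^{\mathbf{o}_k}$; $\ \delta_{k+1,i}^{\mathbf{o}_k}=\mathds{1}_{\mathcal{X}_i}(x_{k+1}^{\mathbf{o}_k})$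 for all $i$.
   Formalization: The constraint sets 𝒳 and 𝒰 are additionally assumed convex; without this the claim fails, e.g. for x_{k+1}=x_k+u_k, N=1, 𝒳=ℝ, 𝒰={−1,1}, one environment state, terminal cost x², where V(±1,1)=0 but V(0,1)=1. *)

theory Defs
  imports "HOL-Analysis.Analysis"
begin

text \<open>
  The library's \<open>convex_on\<close> is for real-valued functions only; this is the same Jensen inequality
  with values in the extended reals. Note that \<open>0 * \<infinity> = 0\<close> there, so the cases with weight 0
  are harmless.
\<close>

definition ereal_convex_on :: "'a::real_vector set \<Rightarrow> ('a \<Rightarrow> ereal) \<Rightarrow> bool" where
  "ereal_convex_on S f \<longleftrightarrow>
     convex S \<and>
     (\<forall>x\<in>S. \<forall>y\<in>S. \<forall>u\<ge>0. \<forall>v\<ge>0. u + v = 1 \<longrightarrow>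
        f (u *\<^sub>R x + v *\<^sub>R y) \<le> ereal u * f x + ereal v * f y)"

text \<open>Not necessarily bounded or closed, unlike the library's \<open>polytope\<close> and \<open>polyhedron\<close>.\<close>

definition polytopic_region :: "(real^'n) set \<Rightarrow> bool" where
  "polytopic_region S \<longleftrightarrow>
     (\<exists>F G :: ((real^'n) \<times> real) set. finite F \<and> finite G \<and>
        S = {x. (\<forall>(a, c)\<in>F. a \<bullet> x \<le> c) \<and> (\<forall>(a, c)\<in>G. a \<bullet> x < c)})"

definition quad :: "real^'k^'k \<Rightarrow> real^'k \<Rightarrow> real" where
  "quad S y = y \<bullet> (S *v y)"

text \<open>Symmetry is not demanded, so that results hold under either convention.\<close>

definition psd :: "real^'k^'k \<Rightarrow> bool" where
  "psd S \<longleftrightarrow> (\<forall>y. 0 \<le> quad S y)"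

text \<open>\<open>T e' e x\<close> is P(e' | e, x) and \<open>Z e ob x\<close> is P(ob | e, x).\<close>

definition hidden_markov_model ::
  "(real^'n) set \<Rightarrow> ('e::finite \<Rightarrow> 'e \<Rightarrow> real^'n \<Rightarrow> real) \<Rightarrow> ('e \<Rightarrow> 'o::finite \<Rightarrow> real^'n \<Rightarrow> real) \<Rightarrow> bool"
where
  "hidden_markov_model X T Z \<longleftrightarrow>
     (\<forall>x\<in>X. \<forall>e. (\<forall>e'. 0 \<le> T e' e x) \<and> (\<Sum>e'\<in>UNIV. T e' e x) = 1 \<and>
                (\<forall>ob. 0 \<le> Z e ob x) \<and> (\<Sum>ob\<in>UNIV. Z e ob x) = 1)"

definition static_environment ::
  "(real^'n) set \<Rightarrow> ('e \<Rightarrow> 'e \<Rightarrow> real^'n \<Rightarrow> real) \<Rightarrow> bool"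
where
  "static_environment X T \<longleftrightarrow>
     (\<forall>x\<in>X. \<forall>e. T e e x = 1 \<and> (\<forall>e'. e' \<noteq> e \<longrightarrow> T e' e x = 0))"

definition piecewise_observation_model ::
  "(real^'n) set \<Rightarrow> nat \<Rightarrow> (nat \<Rightarrow> (real^'n) set) \<Rightarrow> (nat \<Rightarrow> 'e \<Rightarrow> 'o \<Rightarrow> real) \<Rightarrow>
   ('e \<Rightarrow> 'o \<Rightarrow> real^'n \<Rightarrow> real) \<Rightarrow> bool"
where
  "piecewise_observation_model X R XR M Z \<longleftrightarrow>
     (\<forall>i\<in>{1..R}. polytopic_region (XR i)) \<and>
     disjoint_family_on XR {1..R} \<and>
     (\<Union>i\<in>{1..R}. XR i) = X \<and>
     (\<forall>i\<in>{1..R}. \<forall>e ob. M i e ob \<in> {0..1}) \<and>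
     (\<forall>i\<in>{1..R}. \<forall>x\<in>XR i. \<forall>e ob. Z e ob x = M i e ob)"

definition convex_quadratic_cost ::
  "real^'n^'n \<Rightarrow> real^'d^'d \<Rightarrow> real^'n^'n \<Rightarrow> ('e \<Rightarrow> real^'n) \<Rightarrow> ('e \<Rightarrow> real^'d) \<Rightarrow>
   (real^'n \<Rightarrow> real^'d \<Rightarrow> 'e \<Rightarrow> real) \<Rightarrow> (real^'n \<Rightarrow> 'e \<Rightarrow> real) \<Rightarrow> bool"
where
  "convex_quadratic_cost Q Qu QN xg ug h hN \<longleftrightarrow>
     psd Q \<and> psd Qu \<and> psd QN \<and>
     (\<forall>x u e. h x u e = quad Q (x - xg e) + quad Qu (u - ug e)) \<and>
     (\<forall>x e. hN x e = quad QN (x - xg e))"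

text \<open>
  The other half of strict positivity, for the belief b, appears as positivity of the inverse belief
  z = 1/b on the domain of the value function.
\<close>

definition strictly_positive_observations ::
  "(real^'n) set \<Rightarrow> ('e \<Rightarrow> 'o \<Rightarrow> real^'n \<Rightarrow> real) \<Rightarrow> bool"
where
  "strictly_positive_observations X Z \<longleftrightarrow> (\<forall>x\<in>X. \<forall>e ob. Z e ob x \<in> {0<..<1})"

text \<open>
  An observation sequence of length k is a list \<open>os\<close> of length k in chronological order; its
  prefix of length k - 1 is \<open>butlast os\<close>, and \<open>butlast [] = []\<close> matches the convention that the
  sequences with index -1 and 0 coincide. The state at time k is \<open>x k (butlast os)\<close>, so the
  explicit time argument is needed: \<open>x 0 []\<close> and \<open>x 1 []\<close> are different states.
\<close>

definition obs_seqs :: "nat \<Rightarrow> 'o list set" where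
  "obs_seqs k = {os. length os = k}"

definition D_mat :: "(nat \<Rightarrow> 'e \<Rightarrow> 'o \<Rightarrow> real) \<Rightarrow> nat \<Rightarrow> 'o \<Rightarrow> real^'e^'e" where
  "D_mat M i ob = (\<chi> e e'. if e = e' then 1 / M i e ob else 0)"

definition feasible ::
  "real^'n^'n \<Rightarrow> real^'d^'n \<Rightarrow> nat \<Rightarrow> (real^'n) set \<Rightarrow> (real^'d) set \<Rightarrow>
   nat \<Rightarrow> (nat \<Rightarrow> (real^'n) set) \<Rightarrow> (nat \<Rightarrow> 'e::finite \<Rightarrow> 'o::finite \<Rightarrow> real) \<Rightarrow>
   real^'n \<Rightarrow> real^'e \<Rightarrow>
   (nat \<Rightarrow> 'o list \<Rightarrow> real^'d) \<Rightarrow> (nat \<Rightarrow> nat \<Rightarrow> 'o list \<Rightarrow> real) \<Rightarrow>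
   (nat \<Rightarrow> 'o list \<Rightarrow> real^'n) \<Rightarrow> (nat \<Rightarrow> 'o list \<Rightarrow> real^'e) \<Rightarrow> bool"
where
  "feasible A B N X U R XR M xt zt u \<delta> x z \<longleftrightarrow>
     x 0 [] = xt \<and> z 0 [] = zt \<and>
     (\<forall>k<N. \<forall>os\<in>obs_seqs k.
        x (Suc k) os = A *v x k (butlast os) + B *v u k os \<and>
        u k os \<in> U \<and>
        x k (butlast os) \<in> X \<and> x (Suc k) os \<in> X \<and>
        (\<forall>ob. z (Suc k) (os @ [ob]) =
               (\<Sum>i=1..R. \<delta> (Suc k) i os *\<^sub>R (D_mat M i ob *v z k os))) \<and>
        (\<forall>i\<in>{1..R}. \<delta> (Suc k) i os \<in> {0, 1} \<and>
                    \<delta> (Suc k) i os = indicator (XR i) (x (Suc k) os)))"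

definition cost ::
  "nat \<Rightarrow> (real^'n \<Rightarrow> real^'d \<Rightarrow> 'e::finite \<Rightarrow> real) \<Rightarrow> (real^'n \<Rightarrow> 'e \<Rightarrow> real) \<Rightarrow>
   (nat \<Rightarrow> 'o::finite list \<Rightarrow> real^'d) \<Rightarrow>
   (nat \<Rightarrow> 'o list \<Rightarrow> real^'n) \<Rightarrow> (nat \<Rightarrow> 'o list \<Rightarrow> real^'e) \<Rightarrow> real"
where
  "cost N h hN u x z =
     (\<Sum>k=0..<N. \<Sum>os\<in>obs_seqs k. \<Sum>e\<in>UNIV. h (x k (butlast os)) (u k os) e / z k os $ e) +
     (\<Sum>os\<in>obs_seqs N. \<Sum>e\<in>UNIV. hN (x N (butlast os)) e / z N os $ e)"

text \<open>
  The infimum also ranges over the trajectories x and z; these are determined by the inputs through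
  the constraints of \<open>feasible\<close> at every index that enters the cost. The infimum of the empty set
  is \<open>\<infinity>\<close>.
\<close>

definition V ::
  "real^'n^'n \<Rightarrow> real^'d^'n \<Rightarrow> nat \<Rightarrow> (real^'n) set \<Rightarrow> (real^'d) set \<Rightarrow>
   nat \<Rightarrow> (nat \<Rightarrow> (real^'n) set) \<Rightarrow> (nat \<Rightarrow> 'e::finite \<Rightarrow> 'o::finite \<Rightarrow> real) \<Rightarrow>
   (real^'n \<Rightarrow> real^'d \<Rightarrow> 'e \<Rightarrow> real) \<Rightarrow> (real^'n \<Rightarrow> 'e \<Rightarrow> real) \<Rightarrow>
   real^'n \<Rightarrow> real^'e \<Rightarrow> ereal"
where
  "V A B N X U R XR M h hN xt zt =
     Inf {ereal (cost N h hN u x z) | u \<delta> x z. feasible A B N X U R XR M xt zt u \<delta> x z}"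

end

theory Submission
  imports Defs
begin

text \<open>
  Every point of \<open>X\<close> lies in exactly one region, so when the observation model does not depend on
  the state, the binary variables only select the linear update that divides the entries of the
  inverse belief by \<open>G\<close>. Hence the inverse beliefs are positive linear functions of the initial one,
  convex combinations of feasible solutions are feasible, and the cost is a sum of
  quadratic-over-linear functions \<open>quad S y / z\<close>, which are jointly convex. Partial minimization
  then preserves convexity.
\<close>

lemma quad_lincomb:
  "quad S (s *\<^sub>R x + t *\<^sub>R y) = s\<^sup>2 * quad S x + s * t * (x \<bullet> (S *v y) + y \<bullet> (S *v x)) + t\<^sup>2 * quad S y"
  by (simp add: quad_def matrix_vector_right_distrib matrix_vector_mult_scaleR inner_add_left
      inner_add_right algebra_simps power2_eq_square)

lemma pos_convex_combination:
  fixes x y a b :: real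
  assumes "0 < x" "0 < y" "0 \<le> a" "0 \<le> b" "a + b = 1"
  shows "0 < a * x + b * y"
  using assms by (cases "a = 0") (auto intro: add_pos_nonneg)

lemma quad_over_linear_convex:
  assumes "psd S" "0 < z" "0 < w" "0 \<le> a" "0 \<le> b" "a + b = 1"
  shows "quad S (a *\<^sub>R x + b *\<^sub>R y) / (a * z + b * w) \<le> a * (quad S x / z) + b * (quad S y / w)"
proof -
  define c where "c = x \<bullet> (S *v y) + y \<bullet> (S *v x)"
  have "0 \<le> quad S (w *\<^sub>R x + (- z) *\<^sub>R y)"
    using assms(1) unfolding psd_def by blast
  then have gap: "0 \<le> w\<^sup>2 * quad S x - w * z * c + z\<^sup>2 * quad S y"
    unfolding quad_lincomb c_def by simp
  have pos: "0 < a * z + b * w"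
    using assms pos_convex_combination by blast
  have "(a * (quad S x / z) + b * (quad S y / w)) * (a * z + b * w)
      - (a\<^sup>2 * quad S x + a * b * c + b\<^sup>2 * quad S y)
      = a * b / (z * w) * (w\<^sup>2 * quad S x - w * z * c + z\<^sup>2 * quad S y)"
    using assms(2,3) by (simp add: field_simps power2_eq_square)
  also have "0 \<le> \<dots>"
    using assms gap by simp
  finally have "quad S (a *\<^sub>R x + b *\<^sub>R y) \<le> (a * (quad S x / z) + b * (quad S y / w)) * (a * z + b * w)"
    unfolding quad_lincomb c_def by simp
  then show ?thesis
    using pos by (simp add: pos_divide_le_eq)
qed

lemma quad_diff_over_linear_convex:
  assumes "psd S" "0 < z" "0 < w" "0 \<le> a" "0 \<le> b" "a + b = 1"
  shows "quad S (a *\<^sub>R x + b *\<^sub>R y - g) / (a * z + b * w)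
    \<le> a * (quad S (x - g) / z) + b * (quad S (y - g) / w)"
proof -
  have "a *\<^sub>R (x - g) + b *\<^sub>R (y - g) = a *\<^sub>R x + b *\<^sub>R y - (a + b) *\<^sub>R g"
    by (simp add: algebra_simps)
  then show ?thesis
    using quad_over_linear_convex[OF assms, of "x - g" "y - g"] assms(6) by simp
qed

lemma sum_region_update:
  assumes "piecewise_observation_model X R XR M Z" "x \<in> X"
  shows "(\<Sum>i=1..R. indicator (XR i) x *\<^sub>R (D_mat M i ob *v z)) = (\<chi> e. z $ e / Z e ob x)"
proof -
  obtain j where j: "j \<in> {1..R}" "x \<in> XR j"
    using assms unfolding piecewise_observation_model_def by blast
  have other: "indicator (XR i) x = (if i = j then 1 else 0 :: real)" if "i \<in> {1..R}" for i
    using assms(1) j that disjoint_family_onD[of XR "{1..R}" i j]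
    unfolding piecewise_observation_model_def by (auto simp: indicator_def)
  have "(\<Sum>i=1..R. indicator (XR i) x *\<^sub>R (D_mat M i ob *v z))
      = (\<Sum>i=1..R. if i = j then D_mat M i ob *v z else 0)"
    using other by (intro sum.cong) auto
  also have "\<dots> = D_mat M j ob *v z"
    using j(1) by simp
  also have "\<dots> = (\<chi> e. z $ e / M j e ob)"
    by (simp add: vec_eq_iff D_mat_def matrix_vector_mult_def if_distribR if_distrib cong: if_cong)
  also have "\<dots> = (\<chi> e. z $ e / Z e ob x)"
    using assms(1) j unfolding piecewise_observation_model_def by (simp add: vec_eq_iff)
  finally show ?thesis .
qed

lemma feasible_state_independent_iff:
  assumes pw: "piecewise_observation_model X R XR M Z"
    and G: "\<forall>x\<in>X. \<forall>e ob. Z e ob x = G e ob"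
  shows "feasible A B N X U R XR M xt zt u \<delta> x z \<longleftrightarrow>
     x 0 [] = xt \<and> z 0 [] = zt \<and>
     (\<forall>k<N. \<forall>os\<in>obs_seqs k.
        x (Suc k) os = A *v x k (butlast os) + B *v u k os \<and>
        u k os \<in> U \<and> x k (butlast os) \<in> X \<and> x (Suc k) os \<in> X \<and>
        (\<forall>ob. z (Suc k) (os @ [ob]) = (\<chi> e. z k os $ e / G e ob)) \<and>
        (\<forall>i\<in>{1..R}. \<delta> (Suc k) i os = indicator (XR i) (x (Suc k) os)))"
proof -
  have upd: "(\<Sum>i=1..R. d i *\<^sub>R (D_mat M i ob *v w)) = (\<chi> e. w $ e / G e ob)"
    if "y \<in> X" "\<forall>i\<in>{1..R}. d i = indicator (XR i) y" for d y ob w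
  proof -
    have "(\<Sum>i=1..R. d i *\<^sub>R (D_mat M i ob *v w))
        = (\<Sum>i=1..R. indicator (XR i) y *\<^sub>R (D_mat M i ob *v w))"
      using that(2) by (intro sum.cong) auto
    then show ?thesis
      using sum_region_update[OF pw that(1)] G that(1) by simp
  qed
  have bin: "(\<forall>i\<in>{1..R}. d i \<in> {0, 1} \<and> d i = indicator (XR i) y)
      \<longleftrightarrow> (\<forall>i\<in>{1..R}. d i = indicator (XR i) y)" for d :: "nat \<Rightarrow> real" and y
    by (auto simp: indicator_def)
  have step: "(x (Suc k) os \<in> X \<and>
        (\<forall>ob. z (Suc k) (os @ [ob]) = (\<Sum>i=1..R. \<delta> (Suc k) i os *\<^sub>R (D_mat M i ob *v z k os))) \<and>
        (\<forall>i\<in>{1..R}. \<delta> (Suc k) i os = indicator (XR i) (x (Suc k) os)))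
      \<longleftrightarrow> (x (Suc k) os \<in> X \<and>
        (\<forall>ob. z (Suc k) (os @ [ob]) = (\<chi> e. z k os $ e / G e ob)) \<and>
        (\<forall>i\<in>{1..R}. \<delta> (Suc k) i os = indicator (XR i) (x (Suc k) os)))" for k os
  proof (cases "x (Suc k) os \<in> X \<and> (\<forall>i\<in>{1..R}. \<delta> (Suc k) i os = indicator (XR i) (x (Suc k) os))")
    case True
    show ?thesis
      by (simp only: upd[OF True[THEN conjunct1] True[THEN conjunct2]])
  qed blast
  show ?thesis
    unfolding feasible_def bin step ..
qed

lemma feasible_inverse_belief_pos:
  assumes pw: "piecewise_observation_model X R XR M Z"
    and G: "\<forall>x\<in>X. \<forall>e ob. Z e ob x = G e ob"
    and pos: "strictly_positive_observations X Z"
    and feas: "feasible A B N X U R XR M xt zt u \<delta> x z"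
    and zt: "\<And>e. 0 < zt $ e"
    and "k \<le> N" "os \<in> obs_seqs k"
  shows "0 < z k os $ e"
  using \<open>k \<le> N\<close> \<open>os \<in> obs_seqs k\<close>
proof (induction k arbitrary: os)
  case 0
  then show ?case
    using feas zt by (simp add: feasible_def obs_seqs_def)
next
  case (Suc k)
  then obtain ps ob where os: "os = ps @ [ob]" and ps: "ps \<in> obs_seqs k"
    unfolding obs_seqs_def by (cases os rule: rev_cases) auto
  have step: "x (Suc k) ps \<in> X" "z (Suc k) os = (\<chi> e. z k ps $ e / G e ob)"
    using feas[unfolded feasible_state_independent_iff[OF pw G]] Suc.prems(1) ps os
    by (meson Suc_le_lessD)+
  have "0 < G e ob"
    using pos G step(1) unfolding strictly_positive_observations_def
    by (metis greaterThanLessThan_iff)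
  then show ?case
    using Suc.IH[OF _ ps] Suc.prems(1) step(2) by simp
qed

lemma feasible_convex_combination:
  fixes M :: "nat \<Rightarrow> 'e::finite \<Rightarrow> 'o::finite \<Rightarrow> real"
  assumes pw: "piecewise_observation_model X R XR M Z"
    and G: "\<forall>x\<in>X. \<forall>e ob. Z e ob x = G e ob"
    and conv: "convex X" "convex U"
    and feas: "feasible A B N X U R XR M xt1 zt1 u1 \<delta>1 x1 z1"
      "feasible A B N X U R XR M xt2 zt2 u2 \<delta>2 x2 z2"
    and ab: "0 \<le> a" "0 \<le> b" "a + b = 1"
  shows "feasible A B N X U R XR M (a *\<^sub>R xt1 + b *\<^sub>R xt2) (a *\<^sub>R zt1 + b *\<^sub>R zt2)
    (\<lambda>k os. a *\<^sub>R u1 k os + b *\<^sub>R u2 k os)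
    (\<lambda>k i os. indicator (XR i) (a *\<^sub>R x1 k os + b *\<^sub>R x2 k os))
    (\<lambda>k os. a *\<^sub>R x1 k os + b *\<^sub>R x2 k os)
    (\<lambda>k os. a *\<^sub>R z1 k os + b *\<^sub>R z2 k os)"
proof -
  note comb = convexD[OF conv(1) _ _ ab] convexD[OF conv(2) _ _ ab]
  show ?thesis
    unfolding feasible_state_independent_iff[OF pw G]
  proof (intro conjI allI impI ballI)
    fix k ob and os :: "'o list"
    assume k: "k < N" and os: "os \<in> obs_seqs k"
    note step = feas[unfolded feasible_state_independent_iff[OF pw G], THEN conjunct2, THEN conjunct2,
        rule_format, OF k os]
    show "a *\<^sub>R x1 (Suc k) os + b *\<^sub>R x2 (Suc k) os
        = A *v (a *\<^sub>R x1 k (butlast os) + b *\<^sub>R x2 k (butlast os)) + B *v (a *\<^sub>R u1 k os + b *\<^sub>R u2 k os)"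
      using step
      by (simp add: matrix_vector_right_distrib matrix_vector_mult_scaleR scaleR_add_right)
    show "a *\<^sub>R z1 (Suc k) (os @ [ob]) + b *\<^sub>R z2 (Suc k) (os @ [ob])
        = (\<chi> e. (a *\<^sub>R z1 k os + b *\<^sub>R z2 k os) $ e / G e ob)"
      using step by (simp add: vec_eq_iff add_divide_distrib)
    show "a *\<^sub>R u1 k os + b *\<^sub>R u2 k os \<in> U"
      "a *\<^sub>R x1 k (butlast os) + b *\<^sub>R x2 k (butlast os) \<in> X"
      "a *\<^sub>R x1 (Suc k) os + b *\<^sub>R x2 (Suc k) os \<in> X"
      using step by (blast intro: comb)+
  qed (use feas in \<open>simp_all add: feasible_def\<close>)
qed

lemma cost_convex_combination:
  assumes quadratic: "convex_quadratic_cost Q Qu QN xg ug h hN"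
    and pos: "\<And>k os e. k \<le> N \<Longrightarrow> os \<in> obs_seqs k \<Longrightarrow> 0 < z1 k os $ e"
      "\<And>k os e. k \<le> N \<Longrightarrow> os \<in> obs_seqs k \<Longrightarrow> 0 < z2 k os $ e"
    and ab: "0 \<le> a" "0 \<le> b" "a + b = 1"
  shows "cost N h hN (\<lambda>k os. a *\<^sub>R u1 k os + b *\<^sub>R u2 k os)
      (\<lambda>k os. a *\<^sub>R x1 k os + b *\<^sub>R x2 k os) (\<lambda>k os. a *\<^sub>R z1 k os + b *\<^sub>R z2 k os)
    \<le> a * cost N h hN u1 x1 z1 + b * cost N h hN u2 x2 z2"
proof -
  note psd = quadratic[unfolded convex_quadratic_cost_def]
  have stage: "h (a *\<^sub>R x + b *\<^sub>R x') (a *\<^sub>R u + b *\<^sub>R u') e / (a * z + b * z')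
      \<le> a * (h x u e / z) + b * (h x' u' e / z')" if "0 < z" "0 < z'" for x x' u u' e z z'
    using quad_diff_over_linear_convex[of Q z z' a b x x' "xg e"]
      quad_diff_over_linear_convex[of Qu z z' a b u u' "ug e"] psd that ab
    by (simp add: add_divide_distrib distrib_left)
  have terminal: "hN (a *\<^sub>R x + b *\<^sub>R x') e / (a * z + b * z')
      \<le> a * (hN x e / z) + b * (hN x' e / z')" if "0 < z" "0 < z'" for x x' e z z'
    using quad_diff_over_linear_convex[of QN z z' a b x x' "xg e"] psd that ab by simp
  have "cost N h hN (\<lambda>k os. a *\<^sub>R u1 k os + b *\<^sub>R u2 k os)
      (\<lambda>k os. a *\<^sub>R x1 k os + b *\<^sub>R x2 k os) (\<lambda>k os. a *\<^sub>R z1 k os + b *\<^sub>R z2 k os)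
    \<le> (\<Sum>k=0..<N. \<Sum>os\<in>obs_seqs k. \<Sum>e\<in>UNIV.
          a * (h (x1 k (butlast os)) (u1 k os) e / z1 k os $ e)
        + b * (h (x2 k (butlast os)) (u2 k os) e / z2 k os $ e))
     + (\<Sum>os\<in>obs_seqs N. \<Sum>e\<in>UNIV. a * (hN (x1 N (butlast os)) e / z1 N os $ e)
        + b * (hN (x2 N (butlast os)) e / z2 N os $ e))"
    unfolding cost_def using pos
    by (intro add_mono sum_mono) (auto intro!: stage terminal simp del: times_divide_eq_right)
  also have "\<dots> = a * cost N h hN u1 x1 z1 + b * cost N h hN u2 x2 z2"
    unfolding cost_def by (simp add: sum.distrib sum_distrib_left distrib_left)
  finally show ?thesis .
qed

lemma cost_nonneg:
  assumes "convex_quadratic_cost Q Qu QN xg ug h hN"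
    and "\<And>k os e. k \<le> N \<Longrightarrow> os \<in> obs_seqs k \<Longrightarrow> 0 < z k os $ e"
  shows "0 \<le> cost N h hN u x z"
  using assms unfolding cost_def convex_quadratic_cost_def psd_def
  by (intro add_nonneg_nonneg sum_nonneg) (auto intro!: divide_nonneg_pos)

lemma ereal_Inf_convex_combination_le:
  fixes S S1 S2 :: "ereal set"
  assumes nonneg: "\<And>s. s \<in> S1 \<Longrightarrow> 0 \<le> s" "\<And>s. s \<in> S2 \<Longrightarrow> 0 \<le> s"
    and comb: "\<And>s t. s \<in> S1 \<Longrightarrow> t \<in> S2 \<Longrightarrow> Inf S \<le> ereal a * s + ereal b * t"
    and ab: "0 < a" "0 < b"
  shows "Inf S \<le> ereal a * Inf S1 + ereal b * Inf S2"
proof -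
  have ge: "0 \<le> Inf S1" "0 \<le> Inf S2"
    using nonneg by (auto intro: Inf_greatest)
  show ?thesis
  proof (cases "S1 = {} \<or> S2 = {}")
    case True
    then have "ereal a * Inf S1 + ereal b * Inf S2 = \<infinity>"
      using ge ab by (auto simp: top_ereal_def)
    then show ?thesis by (simp only: ereal_less_eq(1))
  next
    case False
    have mult: "ereal c * Inf P = (INF p\<in>P. ereal c * p)" if "0 < c" for c P
      using ereal_Inf_cmult[OF that, of "\<lambda>p. p \<in> P"] by (simp add: setcompr_eq_image)
    have "Inf S \<le> (INF s\<in>S1. INF t\<in>S2. ereal a * s + ereal b * t)"
      using comb by (intro INF_greatest)
    also have "\<dots> = (INF s\<in>S1. ereal a * s + (INF t\<in>S2. ereal b * t))"
      using False nonneg ab by (intro INF_cong refl INF_ereal_add_right) auto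
    also have "\<dots> = (INF s\<in>S1. ereal a * s) + (INF t\<in>S2. ereal b * t)"
      using False nonneg ab mult[of b S2] ge by (intro INF_ereal_add_left) auto
    finally show ?thesis
      using mult False ab by simp
  qed
qed

theorem corollary1:
  fixes A :: "real^'n^'n" and B :: "real^'d^'n" and N R :: nat
    and X :: "(real^'n) set" and U :: "(real^'d) set"
    and XR :: "nat \<Rightarrow> (real^'n) set"
    and T :: "'e::finite \<Rightarrow> 'e \<Rightarrow> real^'n \<Rightarrow> real"
    and Z :: "'e \<Rightarrow> 'o::finite \<Rightarrow> real^'n \<Rightarrow> real"
    and M :: "nat \<Rightarrow> 'e \<Rightarrow> 'o \<Rightarrow> real"
    and Q QN :: "real^'n^'n" and Qu :: "real^'d^'d"
    and xg :: "'e \<Rightarrow> real^'n" and ug :: "'e \<Rightarrow> real^'d"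
    and h :: "real^'n \<Rightarrow> real^'d \<Rightarrow> 'e \<Rightarrow> real" and hN :: "real^'n \<Rightarrow> 'e \<Rightarrow> real"
  assumes horizon: "1 \<le> N"
    and convex_constraints: "convex X" "convex U"
    and hmm: "hidden_markov_model X T Z"
    and static: "static_environment X T"
    and piecewise: "piecewise_observation_model X R XR M Z"
    and quadratic: "convex_quadratic_cost Q Qu QN xg ug h hN"
    and positive: "strictly_positive_observations X Z"
    and state_independent:
      "\<exists>G. (\<forall>e ob. G e ob \<in> {0..1}) \<and> (\<forall>e ob. \<forall>x\<in>X. Z e ob x = G e ob)"
  shows "ereal_convex_on (UNIV \<times> {z. \<forall>e. 0 < z $ e})
           (\<lambda>(x, z). V A B N X U R XR M h hN x z)"
proof -
  obtain G where G: "\<forall>x\<in>X. \<forall>e ob. Z e ob x = G e ob"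
    using state_independent by blast
  note belief_pos = feasible_inverse_belief_pos[OF piecewise G positive]
  define W where "W = V A B N X U R XR M h hN"
  have jensen: "W (a *\<^sub>R x1 + b *\<^sub>R x2) (a *\<^sub>R z1 + b *\<^sub>R z2) \<le> ereal a * W x1 z1 + ereal b * W x2 z2"
    if z: "\<And>e. 0 < z1 $ e" "\<And>e. 0 < z2 $ e" and ab: "0 < a" "0 < b" "a + b = 1"
    for x1 x2 z1 z2 a b
    unfolding W_def V_def
  proof (rule ereal_Inf_convex_combination_le[OF _ _ _ ab(1,2)], goal_cases)
    case (1 s)
    then obtain u \<delta> x z where s: "s = ereal (cost N h hN u x z)"
      and feas: "feasible A B N X U R XR M x1 z1 u \<delta> x z"
      by blast
    show ?case
      using cost_nonneg[OF quadratic belief_pos[OF feas z(1)]] unfolding s by simp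
  next
    case (2 s)
    then obtain u \<delta> x z where s: "s = ereal (cost N h hN u x z)"
      and feas: "feasible A B N X U R XR M x2 z2 u \<delta> x z"
      by blast
    show ?case
      using cost_nonneg[OF quadratic belief_pos[OF feas z(2)]] unfolding s by simp
  next
    case (3 s t)
    then obtain u1 \<delta>1 y1 w1 u2 \<delta>2 y2 w2
      where s: "s = ereal (cost N h hN u1 y1 w1)" and t: "t = ereal (cost N h hN u2 y2 w2)"
        and feas: "feasible A B N X U R XR M x1 z1 u1 \<delta>1 y1 w1"
          "feasible A B N X U R XR M x2 z2 u2 \<delta>2 y2 w2"
      by blast
    have ab': "0 \<le> a" "0 \<le> b"
      using ab by auto
    note comb = feasible_convex_combination[OF piecewise G convex_constraints feas ab' ab(3)]
    note le = cost_convex_combination[OF quadratic belief_pos[OF feas(1) z(1)] belief_pos[OF feas(2) z(2)]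
        ab' ab(3)]
    let ?c = "ereal (cost N h hN (\<lambda>k os. a *\<^sub>R u1 k os + b *\<^sub>R u2 k os)
      (\<lambda>k os. a *\<^sub>R y1 k os + b *\<^sub>R y2 k os) (\<lambda>k os. a *\<^sub>R w1 k os + b *\<^sub>R w2 k os))"
    show ?case
    proof (rule Inf_lower2[OF CollectI])
      show "\<exists>u \<delta> x z. ?c = ereal (cost N h hN u x z) \<and>
          feasible A B N X U R XR M (a *\<^sub>R x1 + b *\<^sub>R x2) (a *\<^sub>R z1 + b *\<^sub>R z2) u \<delta> x z"
        using comb by blast
      show "?c \<le> ereal a * s + ereal b * t"
        unfolding s t using le by simp
    qed
  qed
  show ?thesis
    unfolding ereal_convex_on_def W_def[symmetric]
  proof (intro conjI ballI allI impI)
    show "convex (UNIV \<times> {z :: real^'e. \<forall>e. 0 < z $ e} :: ((real^'n) \<times> (real^'e)) set)"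
      by (intro convex_Times convex_UNIV)
        (auto simp: convex_def intro!: pos_convex_combination)
  next
    fix p q :: "(real^'n) \<times> (real^'e)" and a b :: real
    assume pq: "p \<in> UNIV \<times> {z. \<forall>e. 0 < z $ e}" "q \<in> UNIV \<times> {z. \<forall>e. 0 < z $ e}"
      and ab: "0 \<le> a" "0 \<le> b" "a + b = 1"
    consider "a = 0" "b = 1" | "a = 1" "b = 0" | "0 < a" "0 < b"
      using ab by linarith
    then show "(case a *\<^sub>R p + b *\<^sub>R q of (x, z) \<Rightarrow> W x z)
        \<le> ereal a * (case p of (x, z) \<Rightarrow> W x z) + ereal b * (case q of (x, z) \<Rightarrow> W x z)"
    proof cases
      case 3
      then show ?thesis
        using pq ab(3) jensen[of "snd p" "snd q" a b "fst p" "fst q"]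
        by (auto simp: case_prod_beta)
    qed (simp_all add: zero_ereal_def[symmetric] one_ereal_def[symmetric])
  qed
qed

end
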